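(* Let $r>1$ and $u>r$ be powers of two, write $r=2^\ell$, and let $p=2^b-1>u$ be a Mersenne prime. Let $h:[u]\to[2^b-1]$ be a 4-universal hash function. For each key $x\in[u]$ define $i(x)=h(x)\bmod 2^\ell\in[r]$ (the $\ell$ least significant bits of $h(x)$), $a(x)=\lfloor h(x)/2^{b-1}\rfloor$ (the most significant bit of $h(x)$) and $s(x)=1-2a(x)\in\{-1,1\}$. Let $f=(f_x)_{x\in[u]}\in\mathbb Z^u$ be a fixed vector, let $n$ be the number of $x$ with $f_x\ne 0$, and let $F_m=\sum_{x\in[u]}f_x^m$. Define the Count Sketch counters $C_t=\sum_{x\in[u]} s(x)f_x[i(x)=t]$ for $t\in[r]$, and $X=\sum_{t\in[r]}C_t^2$. Then $$\mathbb E[X]=F_2+(F_1^2-F_2)/p^2,\qquad |\mathbb E[X]-F_2|\le F_2(n-1)/p^2,\qquad \operatorname{Var}[X]<2F_2^2/r.$$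
   Context: $[m]=\{0,\ldots,m-1\}$; $[P]$ denotes $1$ if statement $P$ is true and $0$ otherwise. A random hash function $h:U\to R$ is $k$-universal if for any $k$ distinct keys $x_0,\ldots,x_{k-1}\in U$, the tuple $(h(x_0),\ldots,h(x_{k-1}))$ is uniformly distributed on $R^k$. (The counters $C_t$ are exactly what the Count Sketch stream algorithm produces after processing a stream of key/value updates whose per-key totals are $f_x$.)
   Formalization: The strict bound Var[X] < 2F_2^2/r is proved only when some f_x is nonzero; for f = 0 it would read 0 < 0, which is false. The two expectation claims are proved for every f. *)

theory Defs
  imports "HOL-Probability.Probability" "HOL-Computational_Algebra.Primes"
begin

(* A random function h : U -> R is modelled as a family h w of functions indexed by the
   points w of a probability space M, with each h(x), x in U, an R-valued random variable
   (with respect to the discrete sigma-algebra on R).  k-tuples over R are lists of length k;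
   uniform_count_measure is the uniform distribution on a finite set. *)

definition k_universal ::
    "'w measure \<Rightarrow> nat \<Rightarrow> 'k set \<Rightarrow> 'v set \<Rightarrow> ('w \<Rightarrow> 'k \<Rightarrow> 'v) \<Rightarrow> bool" where
  "k_universal M k U R h \<longleftrightarrow>
     (\<forall>x\<in>U. (\<lambda>w. h w x) \<in> measurable M (count_space R)) \<and>
     (\<forall>xs. distinct xs \<and> length xs = k \<and> set xs \<subseteq> U \<longrightarrow>
        distr M (count_space {vs. length vs = k \<and> set vs \<subseteq> R}) (\<lambda>w. map (h w) xs)
          = uniform_count_measure {vs. length vs = k \<and> set vs \<subseteq> R})"

(* Below, g is a single (non-random) hash function
   with values below 2^b - 1. *)

definition bucket :: "nat \<Rightarrow> (nat \<Rightarrow> nat) \<Rightarrow> nat \<Rightarrow> nat" where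
  "bucket l g x = g x mod 2 ^ l"

definition sign_bit :: "nat \<Rightarrow> (nat \<Rightarrow> nat) \<Rightarrow> nat \<Rightarrow> nat" where
  "sign_bit b g x = g x div 2 ^ (b - 1)"

definition sign_hash :: "nat \<Rightarrow> (nat \<Rightarrow> nat) \<Rightarrow> nat \<Rightarrow> int" where
  "sign_hash b g x = 1 - 2 * int (sign_bit b g x)"

definition counter ::
    "nat \<Rightarrow> nat \<Rightarrow> nat \<Rightarrow> (nat \<Rightarrow> int) \<Rightarrow> (nat \<Rightarrow> nat) \<Rightarrow> nat \<Rightarrow> int" where
  "counter b l u f g t =
     (\<Sum>x<u. sign_hash b g x * f x * of_bool (bucket l g x = t))"

definition second_moment_estimate ::
    "nat \<Rightarrow> nat \<Rightarrow> nat \<Rightarrow> (nat \<Rightarrow> int) \<Rightarrow> (nat \<Rightarrow> nat) \<Rightarrow> int" where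
  "second_moment_estimate b l u f g = (\<Sum>t<2 ^ l. (counter b l u f g t)\<^sup>2)"

definition freq_moment :: "nat \<Rightarrow> (nat \<Rightarrow> int) \<Rightarrow> nat \<Rightarrow> int" where
  "freq_moment u f m = (\<Sum>x<u. f x ^ m)"

end

theory Submission
  imports Defs
begin

text \<open>
  Write \<open>X = F\<^sub>2 + Y\<close>, where \<open>Y\<close> is the sum over \<open>x \<noteq> y\<close> of \<open>f\<^sub>x f\<^sub>y J\<^sub>x\<^sub>y\<close> and
  \<open>J\<^sub>x\<^sub>y = s(x) s(y) [i(x) = i(y)]\<close>. By 4-universality the expectation of \<open>J\<^sub>x\<^sub>y J\<^sub>z\<^sub>v\<close> depends only on
  how the two pairs overlap: it is \<open>D = 1/p\<^sup>4\<close> if they are disjoint, some \<open>B\<close> (\<open>moment_share\<close>) if they share one key, and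
  some \<open>A\<close> (\<open>moment_same\<close>) if they coincide. It is thus \<open>D\<close> plus \<open>B - D\<close> for every matching coordinate plus
  \<open>A - 2B + D\<close> for every double match. The \<open>D\<close> part is exactly the square of the expectation of \<open>Y\<close>,
  so the variance is
  \<open>4 (B - D) \<Sum>\<^sub>x f\<^sub>x\<^sup>2 (F\<^sub>1 - f\<^sub>x)\<^sup>2 + 2 (A - 2B + D) (F\<^sub>2\<^sup>2 - F\<^sub>4)\<close>.
  With \<open>A \<le> 1/r + 1/p\<^sup>2\<close>, \<open>B \<le> 1/(r p\<^sup>2)\<close> and Cauchy-Schwarz, the excess over
  \<open>2 (F\<^sub>2\<^sup>2 - F\<^sub>4) / r\<close> is less than \<open>2 F\<^sub>4 / r\<close>, because \<open>F\<^sub>2\<^sup>2 \<le> u F\<^sub>4\<close>, \<open>2r \<le> u\<close> and \<open>2u \<le> p + 1\<close>.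
\<close>

section \<open>Expectations of products of functions of hash values at distinct keys\<close>

text \<open>The generalized distributive law: multiplying out the sums, each list \<open>vs\<close>
  records which value is chosen in each factor.\<close>

lemma sum_lists_prod_list_map2:
  fixes gs :: "('v \<Rightarrow> real) list"
  assumes "finite R"
  shows "(\<Sum>vs | length vs = length gs \<and> set vs \<subseteq> R. prod_list (map2 (\<lambda>g v. g v) gs vs))
    = prod_list (map (\<lambda>g. sum g R) gs)"
proof (induction gs)
  case Nil
  have "{vs::'v list. vs = [] \<and> set vs \<subseteq> R} = {[]}" by auto
  then show ?case by simp
next
  case (Cons g gs)
  let ?L = "{vs. length vs = length gs \<and> set vs \<subseteq> R}"
  have *: "{vs. length vs = length (g # gs) \<and> set vs \<subseteq> R} = (\<lambda>(v, vs). v # vs) ` (R \<times> ?L)"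
    by (auto simp: length_Suc_conv image_iff)
  have inj: "inj_on (\<lambda>(v, vs). v # vs) (R \<times> ?L)"
    by (auto simp: inj_on_def)
  show ?case
    unfolding * sum.reindex[OF inj]
    by (simp add: case_prod_unfold Cons.IH[symmetric] sum_product sum.cartesian_product)
qed

text \<open>Uniformity of the \<open>k\<close>-tuple turns the expectation into an average over all
  lists, and the distributive law factors that average.\<close>

lemma (in prob_space) k_universal_expectation_prod_list_full:
  fixes gs :: "('v \<Rightarrow> real) list"
  assumes univ: "k_universal M k U R h" and R: "finite R" "R \<noteq> {}"
    and xs: "distinct xs" "set xs \<subseteq> U" "length xs = k" and gs: "length gs = k"
  shows "expectation (\<lambda>w. prod_list (map2 (\<lambda>g x. g (h w x)) gs xs))
    = prod_list (map (\<lambda>g. (\<Sum>v\<in>R. g v) / card R) gs)"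
proof -
  let ?L = "{vs. length vs = k \<and> set vs \<subseteq> R}"
  let ?\<phi> = "\<lambda>vs. prod_list (map2 (\<lambda>g v. g v) gs vs)"
  have L: "finite ?L" "card ?L = card R ^ k"
    using finite_lists_length_eq[OF R(1), of k] card_lists_length_eq[OF R(1), of k]
    by (simp_all add: conj_commute)
  have D: "distr M (count_space ?L) (\<lambda>w. map (h w) xs) = uniform_count_measure ?L"
    using univ xs unfolding k_universal_def by blast
  have meas: "(\<lambda>w. map (h w) xs) \<in> measurable M (count_space ?L)"
  proof -
    have m: "(\<lambda>w. h w x) \<in> measurable M (count_space R)" if "x \<in> U" for x
      using univ that unfolding k_universal_def by blast
    show ?thesis
    \<comment> \<open>For a finite codomain it suffices to test preimages of single lists, and each
      of these is a finite intersection of coordinate events.\<close>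
    proof (rule measurable_count_space_eq2[THEN iffD2])
      show "finite ?L" by (rule L)
      have "(\<lambda>w. map (h w) xs) -` {vs} \<inter> space M \<in> events" if "vs \<in> ?L" for vs
      proof -
        have "(\<lambda>w. map (h w) xs) -` {vs} \<inter> space M
          = {w \<in> space M. \<forall>i\<in>{..<k}. h w (xs ! i) = vs ! i}"
          using that xs(3) by (auto simp: list_eq_iff_nth_eq)
        also have "\<dots> \<in> events"
        proof (rule sets.sets_Collect_finite_All)
          fix i assume i: "i \<in> {..<k}"
          then have "xs ! i \<in> U" "vs ! i \<in> R" using xs that by (auto simp: subset_iff)
          from measurable_sets[OF m[OF this(1)], of "{vs ! i}"] this(2)
          show "{w \<in> space M. h w (xs ! i) = vs ! i} \<in> events"
            by (simp add: vimage_def Int_def conj_commute)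
        qed simp
        finally show ?thesis .
      qed
      moreover have "map (h w) xs \<in> ?L" if "w \<in> space M" for w
        using xs measurable_space[OF m that] by auto
      ultimately show "(\<lambda>w. map (h w) xs) \<in> space M \<rightarrow> ?L \<and>
        (\<forall>a\<in>?L. (\<lambda>w. map (h w) xs) -` {a} \<inter> space M \<in> events)" by blast
    qed
  qed
  have "expectation (\<lambda>w. prod_list (map2 (\<lambda>g x. g (h w x)) gs xs))
      = expectation (\<lambda>w. ?\<phi> (map (h w) xs))"
    by (simp add: zip_map2 case_prod_unfold comp_def)
  also have "\<dots> = integral\<^sup>L (uniform_count_measure ?L) ?\<phi>"
    unfolding D[symmetric] by (rule integral_distr[symmetric, OF meas]) simp
  also have "\<dots> = (\<Sum>vs\<in>?L. ?\<phi> vs) / card R ^ k"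
    using L by (simp add: integral_uniform_count_measure)
  also have "\<dots> = prod_list (map (\<lambda>g. sum g R) gs) / card R ^ k"
    using sum_lists_prod_list_map2[OF R(1), of gs] gs by simp
  also have "\<dots> = prod_list (map (\<lambda>g. sum g R / card R) gs)"
  proof -
    have "prod_list (map (\<lambda>g. sum g R / c) gs) = prod_list (map (\<lambda>g. sum g R) gs) / c ^ length gs"
      for c :: real by (induction gs) simp_all
    then show ?thesis by (simp add: gs)
  qed
  finally show ?thesis .
qed

text \<open>Shorter tuples are padded with fresh keys carrying the constant function 1, whose mean
  is 1. The bound \<open>k \<le> card U\<close> guarantees enough fresh keys.\<close>

lemma (in prob_space) k_universal_expectation_prod_list:
  fixes gs :: "('v \<Rightarrow> real) list"
  assumes univ: "k_universal M k U R h" and R: "finite R" "R \<noteq> {}" and U: "finite U" "k \<le> card U"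
    and xs: "distinct xs" "set xs \<subseteq> U" "length xs \<le> k" and gs: "length gs = length xs"
  shows "expectation (\<lambda>w. prod_list (map2 (\<lambda>g x. g (h w x)) gs xs))
    = prod_list (map (\<lambda>g. (\<Sum>v\<in>R. g v) / card R) gs)"
proof -
  have "k - length xs \<le> card (U - set xs)"
    using U xs by (subst card_Diff_subset) (auto simp: distinct_card)
  then obtain T where T: "T \<subseteq> U - set xs" "card T = k - length xs" "finite T"
    by (rule obtain_subset_with_card_n)
  obtain ys where ys: "set ys = T" "distinct ys"
    using finite_distinct_list[OF T(3)] by blast
  then have len: "length ys = k - length xs"
    using T distinct_card by metis
  let ?gs = "gs @ replicate (length ys) (\<lambda>_. 1)"
  have one: "prod_list (map2 (\<lambda>g x. g (h w x)) (replicate (length ys) (\<lambda>_. 1)) ys) = (1::real)"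
    for w by (induction ys) simp_all
  have "expectation (\<lambda>w. prod_list (map2 (\<lambda>g x. g (h w x)) gs xs))
    = expectation (\<lambda>w. prod_list (map2 (\<lambda>g x. g (h w x)) ?gs (xs @ ys)))"
    using gs one by simp
  also have "\<dots> = prod_list (map (\<lambda>g. (\<Sum>v\<in>R. g v) / card R) ?gs)"
    using xs gs ys T len
    by (intro k_universal_expectation_prod_list_full[OF univ R]) auto
  also have "\<dots> = prod_list (map (\<lambda>g. (\<Sum>v\<in>R. g v) / card R) gs)"
    using R by simp
  finally show ?thesis .
qed

section \<open>Finite sums over matching indices and over residue classes\<close>

text \<open>A match \<open>x = z\<close> leaves \<open>y\<close> and \<open>v\<close> free, so for
  each \<open>x\<close> the squared row sum remains; symmetry of \<open>w\<close> reduces the other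
  three matches to this one. A double match determines the second pair up to order, and both orders
  give the same square.\<close>

lemma sum_weighted_matches:
  fixes w :: "'a \<Rightarrow> 'a \<Rightarrow> real"
  assumes "finite A" and sym: "\<And>x y. w x y = w y x"
  shows "(\<Sum>x\<in>A. \<Sum>y\<in>A. \<Sum>z\<in>A. \<Sum>v\<in>A. w x y * w z v *
           (of_bool (x = z) + of_bool (x = v) + of_bool (y = z) + of_bool (y = v)))
         = 4 * (\<Sum>x\<in>A. (\<Sum>y\<in>A. w x y)\<^sup>2)" (is ?one)
    and "(\<Sum>x\<in>A. \<Sum>y\<in>A. \<Sum>z\<in>A. \<Sum>v\<in>A. w x y * w z v *
           (of_bool (x = z \<and> y = v) + of_bool (x = v \<and> y = z)))
         = 2 * (\<Sum>x\<in>A. \<Sum>y\<in>A. (w x y)\<^sup>2)" (is ?two)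
proof -
  have 1: "(\<Sum>x\<in>A. \<Sum>y\<in>A. \<Sum>z\<in>A. \<Sum>v\<in>A. w x y * w z v * of_bool (x = z))
      = (\<Sum>x\<in>A. (\<Sum>y\<in>A. w x y)\<^sup>2)"
  proof (intro sum.cong refl)
    fix x assume x: "x \<in> A"
    have "(\<Sum>z\<in>A. \<Sum>v\<in>A. w x y * w z v * of_bool (x = z)) = (\<Sum>v\<in>A. w x y * w x v)" for y
      using assms(1) x by (subst sum.swap) (simp add: of_bool_def if_distrib sum.delta cong: if_cong)
    then show "(\<Sum>y\<in>A. \<Sum>z\<in>A. \<Sum>v\<in>A. w x y * w z v * of_bool (x = z)) = (\<Sum>y\<in>A. w x y)\<^sup>2"
      by (simp add: power2_eq_square sum_product)
  qed
  have 2: "(\<Sum>x\<in>A. \<Sum>y\<in>A. \<Sum>z\<in>A. \<Sum>v\<in>A. w x y * w z v * of_bool (x = v))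
      = (\<Sum>x\<in>A. (\<Sum>y\<in>A. w x y)\<^sup>2)"
  proof -
    have "(\<Sum>z\<in>A. \<Sum>v\<in>A. w x y * w z v * of_bool (x = v))
        = (\<Sum>z\<in>A. \<Sum>v\<in>A. w x y * w z v * of_bool (x = z))" for x y
      by (subst sum.swap) (simp add: sym)
    then show ?thesis unfolding 1[symmetric] by simp
  qed
  have swap: "(\<Sum>x\<in>A. \<Sum>y\<in>A. \<Sum>z\<in>A. \<Sum>v\<in>A. G x y z v) = (\<Sum>x\<in>A. \<Sum>y\<in>A. \<Sum>z\<in>A. \<Sum>v\<in>A. G y x z v)"
    for G :: "'a \<Rightarrow> 'a \<Rightarrow> 'a \<Rightarrow> 'a \<Rightarrow> real"
    by (rule sum.swap)
  have 3: "(\<Sum>x\<in>A. \<Sum>y\<in>A. \<Sum>z\<in>A. \<Sum>v\<in>A. w x y * w z v * of_bool (y = z))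
      = (\<Sum>x\<in>A. (\<Sum>y\<in>A. w x y)\<^sup>2)"
    unfolding 1[symmetric] by (subst swap) (simp add: sym)
  have 4: "(\<Sum>x\<in>A. \<Sum>y\<in>A. \<Sum>z\<in>A. \<Sum>v\<in>A. w x y * w z v * of_bool (y = v))
      = (\<Sum>x\<in>A. (\<Sum>y\<in>A. w x y)\<^sup>2)"
    unfolding 2[symmetric] by (subst swap) (simp add: sym)
  show ?one
    by (simp only: distrib_left sum.distrib 1 2 3 4)
  have 5: "(\<Sum>z\<in>A. \<Sum>v\<in>A. w x y * w z v * of_bool (x = z \<and> y = v)) = (w x y)\<^sup>2"
    if "x \<in> A" "y \<in> A" for x y
  proof -
    have inner: "(\<Sum>v\<in>A. w x y * w z v * of_bool (x = z \<and> y = v)) = w x y * w z y * of_bool (x = z)" for z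
      using assms(1) that by (cases "x = z") (simp_all add: of_bool_def if_distrib cong: if_cong)
    show ?thesis
      unfolding inner
      using assms(1) that by (simp add: of_bool_def if_distrib power2_eq_square cong: if_cong)
  qed
  have 6: "(\<Sum>z\<in>A. \<Sum>v\<in>A. w x y * w z v * of_bool (x = v \<and> y = z)) = (w x y)\<^sup>2"
    if "x \<in> A" "y \<in> A" for x y
    using 5[OF that] by (subst sum.swap) (simp add: sym)
  show ?two
    by (simp add: distrib_left sum.distrib 5 6 sum_distrib_left)
qed

lemma card_residue_class_lessThan:
  assumes "t < d"
  shows "card {v. v < c * d \<and> v mod d = t} = (c::nat)"
proof -
  have "{v. v < c * d \<and> v mod d = t} = (\<lambda>i. i * d + t) ` {..<c}"
  proof (intro equalityI subsetI)
    fix v assume v: "v \<in> {v. v < c * d \<and> v mod d = t}"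
    then have "v = v div d * d + t" "v div d < c"
      by (auto simp: less_mult_imp_div_less)
    then show "v \<in> (\<lambda>i. i * d + t) ` {..<c}" by blast
  next
    fix v assume "v \<in> (\<lambda>i. i * d + t) ` {..<c}"
    then obtain i where i: "i < c" "v = i * d + t" by blast
    then have "v < (i + 1) * d" using assms by simp
    also have "\<dots> \<le> c * d" using i by (intro mult_right_mono) auto
    finally show "v \<in> {v. v < c * d \<and> v mod d = t}" using i assms by simp
  qed
  moreover have "inj_on (\<lambda>i. i * d + t) {..<c}"
    using assms by (auto simp: inj_on_def)
  ultimately show ?thesis by (simp add: card_image)
qed


lemma sum_lessThan_add:
  fixes g :: "nat \<Rightarrow> 'a::comm_monoid_add"
  shows "(\<Sum>v<m + n. g v) = (\<Sum>v<m. g v) + (\<Sum>v<n. g (m + v))"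
  by (induction n) (simp_all add: add.assoc)

section \<open>Bounded random variables\<close>

context prob_space
begin

text \<open>Boundedness, unlike integrability, is closed under products, so all expanded terms
  become integrable at once.\<close>

definition bounded_rv :: "('a \<Rightarrow> real) \<Rightarrow> bool" where
  "bounded_rv Y \<longleftrightarrow> Y \<in> borel_measurable M \<and> (\<exists>c. \<forall>w\<in>space M. \<bar>Y w\<bar> \<le> c)"

lemma bounded_rv_integrable: "bounded_rv Y \<Longrightarrow> integrable M Y"
  unfolding bounded_rv_def using integrable_const_bound by (metis AE_I2 real_norm_def)

lemma bounded_rv_const: "bounded_rv (\<lambda>w. c)"
  unfolding bounded_rv_def by auto

lemma bounded_rv_mult:
  assumes "bounded_rv Y" "bounded_rv Z" shows "bounded_rv (\<lambda>w. Y w * Z w)"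
proof -
  obtain c d where c: "\<And>w. w \<in> space M \<Longrightarrow> \<bar>Y w\<bar> \<le> c" and d: "\<And>w. w \<in> space M \<Longrightarrow> \<bar>Z w\<bar> \<le> d"
    using assms unfolding bounded_rv_def by blast
  have "\<bar>Y w * Z w\<bar> \<le> c * d" if "w \<in> space M" for w
    unfolding abs_mult using c[OF that] d[OF that] by (intro mult_mono) auto
  then show ?thesis using assms unfolding bounded_rv_def by auto
qed

lemma bounded_rv_sum:
  assumes "\<And>i. i \<in> I \<Longrightarrow> bounded_rv (Y i)" shows "bounded_rv (\<lambda>w. \<Sum>i\<in>I. Y i w)"
proof -
  obtain c where c: "\<And>i w. i \<in> I \<Longrightarrow> w \<in> space M \<Longrightarrow> \<bar>Y i w\<bar> \<le> c i"
    using assms unfolding bounded_rv_def by metis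
  have "\<bar>\<Sum>i\<in>I. Y i w\<bar> \<le> (\<Sum>i\<in>I. c i)" if "w \<in> space M" for w
    using c that by (intro order_trans[OF sum_abs] sum_mono) auto
  moreover have "(\<lambda>w. \<Sum>i\<in>I. Y i w) \<in> borel_measurable M"
    using assms unfolding bounded_rv_def by (intro borel_measurable_sum) blast
  ultimately show ?thesis unfolding bounded_rv_def by blast
qed

lemma expectation_sum:
  assumes "\<And>i. i \<in> I \<Longrightarrow> bounded_rv (Y i)" "\<And>i. i \<in> I \<Longrightarrow> expectation (Y i) = c i"
  shows "expectation (\<lambda>w. \<Sum>i\<in>I. Y i w) = (\<Sum>i\<in>I. c i)"
  using assms by (subst Bochner_Integration.integral_sum) (auto intro: bounded_rv_integrable)

end

section \<open>The setting and its size inequalities\<close>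

locale count_sketch = prob_space M for M :: "'w measure" +
  fixes h :: "'w \<Rightarrow> nat \<Rightarrow> nat" and u p b l :: nat
  assumes l_pos: "0 < l" and pow_l_less_u: "2 ^ l < u" and u_power: "\<exists>k. u = 2 ^ k"
    and p_eq: "p = 2 ^ b - 1" and u_less_p: "u < p"
    and universal: "k_universal M 4 {..<u} {..<p} h"
begin

lemma Suc_p: "Suc p = 2 ^ b"
  by (simp add: p_eq)

text \<open>Strictly ordered powers of two differ by a factor of at least 2; this applies to
  \<open>2 ^ l < u\<close> and to \<open>u < 2 ^ b\<close>.\<close>

lemma two_pow_l_le_u: "2 * 2 ^ l \<le> u" and two_u_le_Suc_p: "2 * u \<le> Suc p" and l_less_b: "l < b"
proof -
  obtain k where k: "u = 2 ^ k" using u_power by blast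
  have "l < k" using pow_l_less_u unfolding k by (simp add: power_strict_increasing_iff)
  then have "2 ^ Suc l \<le> (2::nat) ^ k" by (intro power_increasing) auto
  then show "2 * 2 ^ l \<le> u" by (simp add: k)
  have "(2::nat) ^ k < 2 ^ b" using u_less_p Suc_p k by linarith
  then have "k < b" by (simp add: power_strict_increasing_iff)
  then have "2 ^ Suc k \<le> (2::nat) ^ b" by (intro power_increasing) auto
  then show "2 * u \<le> Suc p" by (simp add: k Suc_p)
  show "l < b" using \<open>l < k\<close> \<open>k < b\<close> by simp
qed

lemma four_le_u: "4 \<le> u"
proof -
  have "2 ^ 1 \<le> (2::nat) ^ l" using l_pos by (intro power_increasing) auto
  then show ?thesis using two_pow_l_le_u by simp
qed

lemma p_pos: "0 < p"
  using u_less_p by simp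

section \<open>Sums of sign and bucket functions over all hash values\<close>

definition sgn_val :: "nat \<Rightarrow> real" where
  "sgn_val v = 1 - 2 * real (v div 2 ^ (b - 1))"

definition cell :: "nat \<Rightarrow> nat \<Rightarrow> real" where
  "cell t v = of_bool (v mod 2 ^ l = t)"

definition scell :: "nat \<Rightarrow> nat \<Rightarrow> real" where
  "scell t v = sgn_val v * cell t v"

text \<open>
  The bucket and sign bits of a uniform value below \<open>2 ^ b\<close> are independent and unbiased.
  Omitting the value \<open>2 ^ b - 1\<close> removes one element of negative sign from the last bucket
  only, which is where the bias terms \<open>of_bool (t = 2 ^ l - 1)\<close> come from.
\<close>
definition bucket_size :: real where
  "bucket_size = 2 ^ b / 2 ^ l"

lemma bucket_size_mult: "2 ^ l * bucket_size = real p + 1"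
proof -
  have "real (Suc p) = 2 ^ b" unfolding Suc_p by simp
  then show ?thesis by (simp add: bucket_size_def)
qed

lemma pow_b: "(2::nat) ^ b = 2 ^ (b - 1) + 2 ^ (b - 1)"
  using l_less_b by (cases b) simp_all

lemma sgn_val_power2:
  assumes "v < p" shows "(sgn_val v)\<^sup>2 = 1"
proof -
  have "v < 2 * 2 ^ (b - 1)" using assms Suc_p pow_b by simp
  then have "v div 2 ^ (b - 1) < 2" by (simp add: less_mult_imp_div_less)
  then have "v div 2 ^ (b - 1) = 0 \<or> v div 2 ^ (b - 1) = 1" by linarith
  then show ?thesis unfolding sgn_val_def by (elim disjE) simp_all
qed

lemma pow_b_l: "(2::nat) ^ b = 2 ^ (b - l) * 2 ^ l"
  using l_less_b by (simp add: power_add[symmetric])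

text \<open>All \<open>b\<close> bits of \<open>p\<close> are ones: the lowest \<open>l\<close> bits
  put it into the last bucket, and likewise its top bit makes its sign negative.\<close>

lemma cell_p: "t < 2 ^ l \<Longrightarrow> cell t p = of_bool (t = 2 ^ l - 1)"
proof -
  have "p = (2 ^ (b - l) - 1) * 2 ^ l + (2 ^ l - 1)"
    unfolding p_eq pow_b_l by (simp add: diff_mult_distrib)
  then have "p mod 2 ^ l = (2 ^ l - 1) mod 2 ^ l" by (metis mod_mult_self3)
  then show ?thesis by (auto simp: cell_def)
qed

lemma sgn_val_p: "sgn_val p = -1"
proof -
  have "p = 1 * 2 ^ (b - 1) + (2 ^ (b - 1) - 1)" using Suc_p pow_b by simp
  then have "p div 2 ^ (b - 1) = 1"
    by (metis div_mult_self3 div_less diff_less zero_less_numeral zero_less_power power_eq_0_iff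
        zero_neq_numeral add.commute add_0 zero_less_one)
  then show ?thesis by (simp add: sgn_val_def)
qed

text \<open>Adding the missing value \<open>p\<close> completes the range to \<open>2 ^ b\<close>,
  where every residue class modulo \<open>2 ^ l\<close> has \<open>2 ^ (b - l)\<close>
  elements.\<close>

lemma sum_cell:
  assumes "t < 2 ^ l" shows "(\<Sum>v<p. cell t v) = bucket_size - of_bool (t = 2 ^ l - 1)"
proof -
  have "(\<Sum>v<p. cell t v) + cell t p = (\<Sum>v<2 ^ b. cell t v)"
    by (simp flip: Suc_p)
  also have "\<dots> = real (card {v. v < 2 ^ b \<and> v mod 2 ^ l = t})"
    by (simp add: cell_def of_bool_def sum.If_cases Int_def conj_commute)
  also have "\<dots> = bucket_size"
    unfolding pow_b_l card_residue_class_lessThan[OF assms]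
    using l_less_b power_add[of "2::real" "b - l" l] by (simp add: bucket_size_def)
  finally show ?thesis using cell_p[OF assms] by simp
qed

text \<open>Adding \<open>2 ^ (b - 1)\<close> flips the sign and, because \<open>l < b\<close>,
  keeps the bucket. The two halves of the full range cancel, so only the correction for the value
  \<open>p\<close> survives.\<close>

lemma sum_scell:
  assumes "t < 2 ^ l" shows "(\<Sum>v<p. scell t v) = of_bool (t = 2 ^ l - 1)"
proof -
  have neg: "scell t (2 ^ (b - 1) + v) = - scell t v" if "v < 2 ^ (b - 1)" for v
  proof -
    have "b - 1 = l + (b - 1 - l)" using l_less_b by simp
    then have "(2::nat) ^ l dvd 2 ^ (b - 1)" by (metis le_imp_power_dvd le_add1)
    then have "(2 ^ (b - 1) + v) mod 2 ^ l = v mod 2 ^ l"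
      by (metis dvd_def mod_mult_self4)
    then show ?thesis using that by (simp add: scell_def sgn_val_def cell_def)
  qed
  have "(\<Sum>v<p. scell t v) + scell t p = (\<Sum>v<2 ^ b. scell t v)"
    by (simp flip: Suc_p)
  also have "\<dots> = 0"
    unfolding pow_b sum_lessThan_add by (simp add: neg sum_negf del: One_nat_def)
  finally show ?thesis using cell_p[OF assms] sgn_val_p by (simp add: scell_def)
qed

section \<open>Moments of functions of the random hash values\<close>

lemma hash_measurable: "x < u \<Longrightarrow> (\<lambda>w. h w x) \<in> measurable M (count_space {..<p})"
  using universal unfolding k_universal_def by simp

lemma hash_less: "x < u \<Longrightarrow> w \<in> space M \<Longrightarrow> h w x < p"
  using measurable_space[OF hash_measurable] by simp

lemma bounded_rv_hash:
  assumes "x < u" shows "bounded_rv (\<lambda>w. g (h w x))"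
proof -
  have "(\<lambda>w. g (h w x)) \<in> borel_measurable M"
    by (rule measurable_compose[OF hash_measurable[OF assms]]) simp
  moreover have "\<bar>g (h w x)\<bar> \<le> (\<Sum>v<p. \<bar>g v\<bar>)" if "w \<in> space M" for w
    using hash_less[OF assms that] by (intro member_le_sum) auto
  ultimately show ?thesis unfolding bounded_rv_def by blast
qed

lemmas bounded_rv_intros = bounded_rv_const bounded_rv_mult bounded_rv_sum bounded_rv_hash

text \<open>The expectation of \<open>g (h w x)\<close> for any single key \<open>x < u\<close>, by
  uniformity.\<close>

definition mean :: "(nat \<Rightarrow> real) \<Rightarrow> real" where
  "mean g = (\<Sum>v<p. g v) / real p"

lemma expectation_hash_prod_list:
  assumes "distinct xs" "set xs \<subseteq> {..<u}" "length xs \<le> 4" "length gs = length xs"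
  shows "expectation (\<lambda>w. prod_list (map2 (\<lambda>g x. g (h w x)) gs xs)) = prod_list (map mean gs)"
proof -
  have "{..<p} \<noteq> {}" using p_pos by auto
  from k_universal_expectation_prod_list[OF universal _ this _ _ assms] show ?thesis
    using four_le_u by (simp add: mean_def[abs_def])
qed

lemma expectation_hash2:
  assumes "x < u" "y < u" "x \<noteq> y"
  shows "expectation (\<lambda>w. g1 (h w x) * g2 (h w y)) = mean g1 * mean g2"
  using expectation_hash_prod_list[of "[x, y]" "[g1, g2]"] assms by simp

lemma expectation_hash3:
  assumes "x < u" "y < u" "z < u" "x \<noteq> y" "x \<noteq> z" "y \<noteq> z"
  shows "expectation (\<lambda>w. g1 (h w x) * g2 (h w y) * g3 (h w z)) = mean g1 * mean g2 * mean g3"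
  using expectation_hash_prod_list[of "[x, y, z]" "[g1, g2, g3]"] assms by (simp add: mult.assoc)

lemma expectation_hash4:
  assumes "x < u" "y < u" "z < u" "v < u" "distinct [x, y, z, v]"
  shows "expectation (\<lambda>w. g1 (h w x) * g2 (h w y) * (g3 (h w z) * g4 (h w v)))
    = mean g1 * mean g2 * (mean g3 * mean g4)"
  using expectation_hash_prod_list[of "[x, y, z, v]" "[g1, g2, g3, g4]"] assms
  by (simp add: mult.assoc)

lemma mean_scell: "t < 2 ^ l \<Longrightarrow> mean (scell t) = of_bool (t = 2 ^ l - 1) / real p"
  and mean_cell: "t < 2 ^ l \<Longrightarrow> mean (cell t) = (bucket_size - of_bool (t = 2 ^ l - 1)) / real p"
  by (simp_all add: mean_def sum_scell sum_cell)

section \<open>Collisions and their mixed second moments\<close>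

definition collision :: "nat \<Rightarrow> nat \<Rightarrow> 'w \<Rightarrow> real" where
  "collision x y w = sgn_val (h w x) * sgn_val (h w y) * of_bool (h w x mod 2 ^ l = h w y mod 2 ^ l)"

lemma collision_commute: "collision x y w = collision y x w"
  by (auto simp: collision_def)

text \<open>Splitting by bucket turns a collision into products of functions of single hash values.\<close>
lemma collision_eq_sum: "collision x y w = (\<Sum>t<2 ^ l. scell t (h w x) * scell t (h w y))"
proof -
  have "(\<Sum>t<2 ^ l. scell t (h w x) * scell t (h w y))
    = (\<Sum>t<2 ^ l. if t = h w x mod 2 ^ l then collision x y w else 0)"
    by (intro sum.cong) (auto simp: scell_def cell_def collision_def)
  also have "\<dots> = collision x y w" by simp
  finally show ?thesis by simp
qed

lemma bounded_rv_collision: "x < u \<Longrightarrow> y < u \<Longrightarrow> bounded_rv (collision x y)"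
  unfolding collision_eq_sum[abs_def] by (intro bounded_rv_intros)

lemma sum_of_bool_last:
  fixes g :: "nat \<Rightarrow> real"
  shows "(\<Sum>t<2 ^ l. g t * of_bool (t = 2 ^ l - 1)) = g (2 ^ l - 1)"
proof -
  have "(\<Sum>t<2 ^ l. g t * of_bool (t = 2 ^ l - 1)) = (\<Sum>t<2 ^ l. if t = 2 ^ l - 1 then g t else 0)"
    by (intro sum.cong) auto
  then show ?thesis by simp
qed

text \<open>Only the last bucket has a nonzero signed mean, namely \<open>1 / p\<close>, so the sum
  collapses to one term.\<close>

lemma sum_mean_scell: "(\<Sum>t<2 ^ l. g t * (mean (scell t) * mean (scell t))) = g (2 ^ l - 1) / (real p)\<^sup>2"
proof -
  have "(\<Sum>t<2 ^ l. g t * (mean (scell t) * mean (scell t)))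
      = (\<Sum>t<2 ^ l. g t * of_bool (t = 2 ^ l - 1) / (real p)\<^sup>2)"
    by (intro sum.cong) (auto simp: mean_scell power2_eq_square)
  also have "\<dots> = g (2 ^ l - 1) / (real p)\<^sup>2"
    by (simp add: sum_of_bool_last flip: sum_divide_distrib)
  finally show ?thesis .
qed

lemma expectation_collision:
  assumes "x < u" "y < u" "x \<noteq> y"
  shows "expectation (collision x y) = 1 / (real p)\<^sup>2"
proof -
  have "expectation (collision x y) = (\<Sum>t<2 ^ l. mean (scell t) * mean (scell t))"
    unfolding collision_eq_sum[abs_def]
    by (intro expectation_sum bounded_rv_mult bounded_rv_hash expectation_hash2 assms)
  then show ?thesis using sum_mean_scell[of "\<lambda>_. 1"] by simp
qed

text \<open>The sign of the shared key occurs twice and squares to 1, so \<open>x\<close>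
  contributes an unsigned \<open>cell\<close>; both collisions force all three keys into the bucket
  of \<open>x\<close>.\<close>

lemma collision_mult_share:
  assumes "x < u" "w \<in> space M"
  shows "collision x y w * collision x z w
    = (\<Sum>t<2 ^ l. cell t (h w x) * scell t (h w y) * scell t (h w z))"
proof -
  have "(\<Sum>t<2 ^ l. cell t (h w x) * scell t (h w y) * scell t (h w z))
    = (\<Sum>t<2 ^ l. if t = h w x mod 2 ^ l then (sgn_val (h w x))\<^sup>2 * scell t (h w y) * scell t (h w z) else 0)"
    using sgn_val_power2[OF hash_less[OF assms]] by (intro sum.cong) (auto simp: cell_def)
  also have "\<dots> = collision x y w * collision x z w"
    by (simp add: scell_def cell_def collision_def power2_eq_square)
  finally show ?thesis by simp
qed

text \<open>The case \<open>z = y\<close> of the shared-key identity, where the sign of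
  \<open>y\<close> squares to 1 as well.\<close>

lemma collision_power2:
  assumes "x < u" "y < u" "w \<in> space M"
  shows "collision x y w * collision x y w = (\<Sum>t<2 ^ l. cell t (h w x) * cell t (h w y))"
proof -
  have "scell t (h w y) * scell t (h w y) = cell t (h w y)" for t
    using sgn_val_power2[OF hash_less[OF assms(2,3)]]
    by (auto simp: scell_def cell_def power2_eq_square)
  then show ?thesis
    by (simp add: collision_mult_share[OF assms(1,3)] mult.assoc)
qed

text \<open>Closed forms of \<open>A\<close>, \<open>B\<close> and \<open>D\<close>. With
  \<open>m = bucket_size\<close> and \<open>r = 2 ^ l\<close>, the numerator of
  \<open>moment_same\<close> is \<open>(r - 1) * m^2 + (m - 1)^2\<close>, the sum of squared bucket
  sizes with one value missing from the last bucket. \<open>moment_share\<close> is the probability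
  of the last bucket divided by \<open>p^2\<close>.\<close>

definition moment_same :: real where "moment_same = (2 ^ l * bucket_size\<^sup>2 - 2 * bucket_size + 1) / (real p)\<^sup>2"
definition moment_share :: real where "moment_share = (bucket_size - 1) / real p ^ 3"
definition moment_disjoint :: real where "moment_disjoint = 1 / real p ^ 4"

lemma expectation_collision_same:
  assumes "x < u" "y < u" "x \<noteq> y"
  shows "expectation (\<lambda>w. collision x y w * collision x y w) = moment_same"
proof -
  have "expectation (\<lambda>w. collision x y w * collision x y w)
      = expectation (\<lambda>w. \<Sum>t<2 ^ l. cell t (h w x) * cell t (h w y))"
    using assms by (intro Bochner_Integration.integral_cong) (auto simp: collision_power2)
  also have "\<dots> = (\<Sum>t<2 ^ l. mean (cell t) * mean (cell t))"
    by (intro expectation_sum bounded_rv_mult bounded_rv_hash expectation_hash2 assms)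
  \<comment> \<open>The indicator of the last bucket is its own square, so the squared mean is
    linear in it.\<close>
  also have "\<dots> = (\<Sum>t::nat<2 ^ l. (bucket_size\<^sup>2 + (1 - 2 * bucket_size) * of_bool (t = 2 ^ l - 1)) / (real p)\<^sup>2)"
    by (intro sum.cong) (auto simp: mean_cell power2_eq_square field_simps)
  also have "\<dots> = moment_same"
    unfolding sum_divide_distrib[symmetric] sum.distrib sum_of_bool_last by (simp add: moment_same_def)
  finally show ?thesis .
qed

lemma expectation_collision_share:
  assumes "x < u" "y < u" "z < u" "x \<noteq> y" "x \<noteq> z" "y \<noteq> z"
  shows "expectation (\<lambda>w. collision x y w * collision x z w) = moment_share"
proof -
  have "expectation (\<lambda>w. collision x y w * collision x z w)
      = expectation (\<lambda>w. \<Sum>t<2 ^ l. cell t (h w x) * scell t (h w y) * scell t (h w z))"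
    using assms by (intro Bochner_Integration.integral_cong) (auto simp: collision_mult_share)
  also have "\<dots> = (\<Sum>t<2 ^ l. mean (cell t) * mean (scell t) * mean (scell t))"
    by (intro expectation_sum bounded_rv_mult bounded_rv_hash expectation_hash3 assms)
  also have "\<dots> = mean (cell (2 ^ l - 1)) / (real p)\<^sup>2"
    unfolding mult.assoc by (rule sum_mean_scell)
  also have "\<dots> = moment_share"
    by (simp add: mean_cell moment_share_def power2_eq_square power3_eq_cube)
  finally show ?thesis .
qed

lemma expectation_collision_disjoint:
  assumes "x < u" "y < u" "z < u" "v < u" "distinct [x, y, z, v]"
  shows "expectation (\<lambda>w. collision x y w * collision z v w) = moment_disjoint"
proof -
  have "expectation (\<lambda>w. collision x y w * collision z v w)
     = (\<Sum>t<2 ^ l. \<Sum>t'<2 ^ l. mean (scell t) * mean (scell t) * (mean (scell t') * mean (scell t')))"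
    unfolding collision_eq_sum sum_product
    by (intro expectation_sum bounded_rv_sum bounded_rv_mult bounded_rv_hash expectation_hash4 assms)
  also have "\<dots> = (\<Sum>t<2 ^ l. 1 * (mean (scell t) * mean (scell t)))
      * (\<Sum>t<2 ^ l. 1 * (mean (scell t) * mean (scell t)))"
    by (simp add: sum_product)
  also have "\<dots> = moment_disjoint"
    unfolding sum_mean_scell by (simp add: moment_disjoint_def power2_eq_square power4_eq_xxxx)
  finally show ?thesis .
qed

text \<open>Coinciding pairs have two matching coordinates and one double match, giving
  \<open>D + 2 (B - D) + (A - 2B + D) = A\<close>. As \<open>x \<noteq> y\<close> and
  \<open>z \<noteq> v\<close>, any other overlap is exactly one shared key, moved to the front by
  symmetry of \<open>collision\<close>.\<close>

lemma expectation_collision_mult: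
  assumes "x < u" "y < u" "z < u" "v < u" "x \<noteq> y" "z \<noteq> v"
  shows "expectation (\<lambda>w. collision x y w * collision z v w)
    = moment_disjoint + (moment_share - moment_disjoint) * (of_bool (x = z) + of_bool (x = v) + of_bool (y = z) + of_bool (y = v))
        + (moment_same - 2 * moment_share + moment_disjoint) * (of_bool (x = z \<and> y = v) + of_bool (x = v \<and> y = z))"
proof -
  consider "x = z" "y = v" | "x = v" "y = z" | "x = z" "y \<noteq> v" | "x = v" "y \<noteq> z"
    | "y = z" "x \<noteq> v" | "y = v" "x \<noteq> z" | "distinct [x, y, z, v]"
    using assms by auto
  then show ?thesis
  proof cases
    case 1
    then show ?thesis using assms expectation_collision_same[of x y] by simp
  next
    case 2
    then show ?thesis using assms expectation_collision_same[of x y] by (simp add: collision_commute[of z v])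
  next
    case 3
    then show ?thesis using assms expectation_collision_share[of x y v] by simp
  next
    case 4
    then show ?thesis using assms expectation_collision_share[of x y z] by (simp add: collision_commute[of z v])
  next
    case 5
    then show ?thesis using assms expectation_collision_share[of y x v] by (simp add: collision_commute[of x z])
  next
    case 6
    then show ?thesis using assms expectation_collision_share[of y x z]
      by (simp add: collision_commute[of x v] collision_commute[of z v])
  next
    case 7
    then show ?thesis using assms expectation_collision_disjoint[of x y z v] by auto
  qed
qed

section \<open>Expectation and variance of quadratic forms in the collisions\<close>

text \<open>The zero diagonal of \<open>W\<close> removes the terms with \<open>x = y\<close>; all
  others share the expectation \<open>1 / p^2\<close>.\<close>

lemma expectation_quadratic_form:
  assumes "\<And>x. W x x = 0"
  shows "expectation (\<lambda>w. \<Sum>x<u. \<Sum>y<u. W x y * collision x y w)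
    = (\<Sum>x<u. \<Sum>y<u. W x y) / (real p)\<^sup>2"
proof -
  have "expectation (\<lambda>w. W x y * collision x y w) = W x y / (real p)\<^sup>2"
    if "x \<in> {..<u}" "y \<in> {..<u}" for x y
    using that assms expectation_collision[of x y] by (cases "x = y") simp_all
  moreover have "bounded_rv (\<lambda>w. W x y * collision x y w)" if "x \<in> {..<u}" "y \<in> {..<u}" for x y
    using that by (intro bounded_rv_mult bounded_rv_const bounded_rv_collision) auto
  ultimately have "expectation (\<lambda>w. \<Sum>x<u. \<Sum>y<u. W x y * collision x y w)
      = (\<Sum>x<u. \<Sum>y<u. W x y / (real p)\<^sup>2)"
    by (intro expectation_sum bounded_rv_sum)
  then show ?thesis by (simp add: sum_divide_distrib)
qed

lemma variance_quadratic_form: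
  assumes diag: "\<And>x. W x x = 0" and sym: "\<And>x y. W x y = W y x"
  shows "variance (\<lambda>w. \<Sum>x<u. \<Sum>y<u. W x y * collision x y w)
    = 4 * (moment_share - moment_disjoint) * (\<Sum>x<u. (\<Sum>y<u. W x y)\<^sup>2)
        + 2 * (moment_same - 2 * moment_share + moment_disjoint) * (\<Sum>x<u. \<Sum>y<u. (W x y)\<^sup>2)"
proof -
  let ?Y = "\<lambda>w. \<Sum>x<u. \<Sum>y<u. W x y * collision x y w"
  let ?J = "\<lambda>x y z v. of_bool (x = z) + of_bool (x = v) + of_bool (y = z) + of_bool (y = v) :: real"
  let ?I = "\<lambda>x y z v. of_bool (x = z \<and> y = v) + of_bool (x = v \<and> y = z) :: real"
  let ?Z = "\<lambda>x y z v w. W x y * W z v * (collision x y w * collision z v w)"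
  have bd: "bounded_rv (?Z x y z v)" if "x \<in> {..<u}" "y \<in> {..<u}" "z \<in> {..<u}" "v \<in> {..<u}" for x y z v
    using that by (intro bounded_rv_mult bounded_rv_const bounded_rv_collision) auto
  have ex: "expectation (?Z x y z v) = moment_disjoint * (W x y * W z v)
      + (moment_share - moment_disjoint) * (W x y * W z v * ?J x y z v)
          + (moment_same - 2 * moment_share + moment_disjoint) * (W x y * W z v * ?I x y z v)"
    if "x \<in> {..<u}" "y \<in> {..<u}" "z \<in> {..<u}" "v \<in> {..<u}" for x y z v
  \<comment> \<open>The moment formula needs distinct keys within each pair; otherwise the weight is
    zero and both sides vanish.\<close>
  proof (cases "x = y \<or> z = v")
    case True
    then have zero: "W x y * W z v = 0" using diag by auto
    show ?thesis unfolding zero by simp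
  next
    case False
    have expand: "c * (d + k * j + m * i) = d * c + k * (c * j) + m * (c * i)" for c d k j m i :: real
      by (simp add: algebra_simps)
    have "expectation (?Z x y z v)
        = W x y * W z v * expectation (\<lambda>w. collision x y w * collision z v w)"
      by (rule integral_mult_right_zero)
    also have "expectation (\<lambda>w. collision x y w * collision z v w)
        = moment_disjoint + (moment_share - moment_disjoint) * ?J x y z v
            + (moment_same - 2 * moment_share + moment_disjoint) * ?I x y z v"
      using that False by (intro expectation_collision_mult) auto
    finally show ?thesis unfolding expand .
  qed
  have Y2: "(?Y w)\<^sup>2 = (\<Sum>x<u. \<Sum>y<u. \<Sum>z<u. \<Sum>v<u. ?Z x y z v w)" for w
  proof -
    have "(?Y w)\<^sup>2 = (\<Sum>x<u. \<Sum>y<u. W x y * collision x y w * ?Y w)"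
      by (simp add: power2_eq_square sum_distrib_right)
    also have "\<dots> = (\<Sum>x<u. \<Sum>y<u. \<Sum>z<u. \<Sum>v<u. ?Z x y z v w)"
      unfolding sum_distrib_left by (intro sum.cong refl) (simp only: mult_ac)
    finally show ?thesis .
  qed
  have bY: "bounded_rv ?Y"
    by (intro bounded_rv_sum bounded_rv_mult bounded_rv_const bounded_rv_collision) auto
  have "expectation (\<lambda>w. (?Y w)\<^sup>2) = (\<Sum>x<u. \<Sum>y<u. \<Sum>z<u. \<Sum>v<u. moment_disjoint * (W x y * W z v)
      + (moment_share - moment_disjoint) * (W x y * W z v * ?J x y z v)
          + (moment_same - 2 * moment_share + moment_disjoint) * (W x y * W z v * ?I x y z v))"
    unfolding Y2 by (intro expectation_sum bounded_rv_sum bd ex)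
  also have "\<dots> = moment_disjoint * (\<Sum>x<u. \<Sum>y<u. \<Sum>z<u. \<Sum>v<u. W x y * W z v)
      + (moment_share - moment_disjoint) * (\<Sum>x<u. \<Sum>y<u. \<Sum>z<u. \<Sum>v<u. W x y * W z v * ?J x y z v)
      + (moment_same - 2 * moment_share + moment_disjoint) * (\<Sum>x<u. \<Sum>y<u. \<Sum>z<u. \<Sum>v<u. W x y * W z v * ?I x y z v)"
    unfolding sum.distrib sum_distrib_left ..
  also have "(\<Sum>x<u. \<Sum>y<u. \<Sum>z<u. \<Sum>v<u. W x y * W z v) = (\<Sum>x<u. \<Sum>y<u. W x y)\<^sup>2"
  proof -
    have "(\<Sum>x<u. \<Sum>y<u. \<Sum>z<u. \<Sum>v<u. W x y * W z v)
        = (\<Sum>x<u. \<Sum>y<u. W x y * (\<Sum>z<u. \<Sum>v<u. W z v))"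
      by (simp add: sum_distrib_left)
    then show ?thesis by (simp add: power2_eq_square sum_distrib_right)
  qed
  also have "moment_disjoint * (\<Sum>x<u. \<Sum>y<u. W x y)\<^sup>2
      + (moment_share - moment_disjoint) * (\<Sum>x<u. \<Sum>y<u. \<Sum>z<u. \<Sum>v<u. W x y * W z v * ?J x y z v)
      + (moment_same - 2 * moment_share + moment_disjoint) * (\<Sum>x<u. \<Sum>y<u. \<Sum>z<u. \<Sum>v<u. W x y * W z v * ?I x y z v)
    = moment_disjoint * (\<Sum>x<u. \<Sum>y<u. W x y)\<^sup>2
      + (moment_share - moment_disjoint) * (4 * (\<Sum>x<u. (\<Sum>y<u. W x y)\<^sup>2))
      + (moment_same - 2 * moment_share + moment_disjoint) * (2 * (\<Sum>x<u. \<Sum>y<u. (W x y)\<^sup>2))"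
    unfolding sum_weighted_matches[where w = W, OF finite_lessThan sym] ..
  finally have "expectation (\<lambda>w. (?Y w)\<^sup>2) = \<dots>" .
  \<comment> \<open>Since \<open>moment_disjoint\<close> is exactly the square of
    \<open>1 / p^2\<close>, this term cancels in the variance.\<close>
  moreover have "(expectation ?Y)\<^sup>2 = moment_disjoint * (\<Sum>x<u. \<Sum>y<u. W x y)\<^sup>2"
    unfolding expectation_quadratic_form[OF diag]
    by (simp add: moment_disjoint_def power_divide flip: power_mult)
  moreover have "variance ?Y = expectation (\<lambda>w. (?Y w)\<^sup>2) - (expectation ?Y)\<^sup>2"
    by (intro variance_eq bounded_rv_integrable bY)
      (unfold power2_eq_square, rule bounded_rv_mult[OF bY bY])
  ultimately show ?thesis by (simp add: algebra_simps)
qed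

text \<open>After squaring the counters, the bucket sum is moved innermost, where it forms
  collisions. A key always collides with itself with squared sign 1, so the diagonal gives the
  non-random summand.\<close>

lemma second_moment_estimate_eq:
  assumes "w \<in> space M"
  shows "real_of_int (second_moment_estimate b l u f (h w))
    = freq_moment u f 2
        + (\<Sum>x<u. \<Sum>y<u. of_bool (x \<noteq> y) * real_of_int (f x) * real_of_int (f y) * collision x y w)"
proof -
  have counter: "real_of_int (counter b l u f (h w) t) = (\<Sum>x<u. real_of_int (f x) * scell t (h w x))" for t
    unfolding counter_def scell_def cell_def sgn_val_def sign_hash_def sign_bit_def bucket_def
    by (simp add: mult_ac)
  have "real_of_int (second_moment_estimate b l u f (h w))
      = (\<Sum>t<2 ^ l. \<Sum>x<u. \<Sum>y<u. real_of_int (f x) * scell t (h w x) *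
          (real_of_int (f y) * scell t (h w y)))"
    unfolding second_moment_estimate_def
    by (simp add: counter power2_eq_square sum_product)
  also have "\<dots> = (\<Sum>x<u. \<Sum>t<2 ^ l. \<Sum>y<u. real_of_int (f x) * scell t (h w x) *
      (real_of_int (f y) * scell t (h w y)))"
    by (rule sum.swap)
  also have "\<dots> = (\<Sum>x<u. \<Sum>y<u. \<Sum>t<2 ^ l. real_of_int (f x) * scell t (h w x) *
      (real_of_int (f y) * scell t (h w y)))"
    by (rule sum.cong[OF refl]) (rule sum.swap)
  also have "\<dots> = (\<Sum>x<u. \<Sum>y<u. real_of_int (f x) * real_of_int (f y) * collision x y w)"
    by (simp add: collision_eq_sum sum_distrib_left mult_ac)
  also have "\<dots> = (\<Sum>x<u. (real_of_int (f x))\<^sup>2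
      + (\<Sum>y<u. of_bool (x \<noteq> y) * real_of_int (f x) * real_of_int (f y) * collision x y w))"
  proof (intro sum.cong refl)
    fix x assume x: "x \<in> {..<u}"
    have "collision x x w = 1"
      using sgn_val_power2[OF hash_less[OF _ assms]] x by (simp add: collision_def power2_eq_square)
    then have "(\<Sum>y<u. real_of_int (f x) * real_of_int (f y) * collision x y w)
        = (\<Sum>y<u. (if y = x then (real_of_int (f x))\<^sup>2 else 0)
            + of_bool (x \<noteq> y) * real_of_int (f x) * real_of_int (f y) * collision x y w)"
      by (intro sum.cong) (auto simp: power2_eq_square)
    also have "\<dots> = (real_of_int (f x))\<^sup>2
        + (\<Sum>y<u. of_bool (x \<noteq> y) * real_of_int (f x) * real_of_int (f y) * collision x y w)"
      using x by (simp add: sum.distrib)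
    finally show "(\<Sum>y<u. real_of_int (f x) * real_of_int (f y) * collision x y w)
      = (real_of_int (f x))\<^sup>2
          + (\<Sum>y<u. of_bool (x \<noteq> y) * real_of_int (f x) * real_of_int (f y) * collision x y w)" .
  qed
  also have "\<dots> = freq_moment u f 2
      + (\<Sum>x<u. \<Sum>y<u. of_bool (x \<noteq> y) * real_of_int (f x) * real_of_int (f y) * collision x y w)"
    by (simp add: freq_moment_def sum.distrib)
  finally show ?thesis .
qed

section \<open>Bounds on the variance coefficients\<close>

lemma bucket_size_ge: "4 \<le> bucket_size"
proof -
  have "4 * 2 ^ l \<le> Suc p" using two_pow_l_le_u two_u_le_Suc_p by linarith
  then have "real (4 * 2 ^ l) \<le> real (Suc p)" by (simp only: of_nat_le_iff)
  then have "2 ^ l * 4 \<le> 2 ^ l * bucket_size" unfolding bucket_size_mult by simp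
  then show ?thesis by simp
qed

text \<open>With \<open>m = bucket_size\<close> and \<open>r = 2 ^ l\<close>, the relation
  \<open>r * m = p + 1\<close> gives
  \<open>r * m^2 - 2 * m = m * (p - 1) = (p^2 - 1) / r\<close>.\<close>

lemma moment_same_le: "moment_same \<le> 1 / 2 ^ l + 1 / (real p)\<^sup>2"
proof -
  have "2 ^ l * bucket_size\<^sup>2 - 2 * bucket_size = bucket_size * (2 ^ l * bucket_size - 2)"
    by (simp add: power2_eq_square algebra_simps)
  also have "\<dots> = bucket_size * (real p - 1)" unfolding bucket_size_mult by simp
  also have "\<dots> = ((real p)\<^sup>2 - 1) / 2 ^ l"
  proof -
    have bucket_size: "bucket_size = (real p + 1) / 2 ^ l" unfolding bucket_size_mult[symmetric] by simp
    show ?thesis unfolding bucket_size by (simp add: power2_eq_square algebra_simps)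
  qed
  also have "\<dots> \<le> (real p)\<^sup>2 / 2 ^ l" by (intro divide_right_mono) auto
  finally have "moment_same \<le> ((real p)\<^sup>2 / 2 ^ l + 1) / (real p)\<^sup>2"
    unfolding moment_same_def by (intro divide_right_mono) auto
  also have "\<dots> = 1 / 2 ^ l + 1 / (real p)\<^sup>2"
    using p_pos by (simp add: add_divide_distrib)
  finally show ?thesis .
qed

lemma moment_share_le: "moment_share \<le> 1 / (2 ^ l * (real p)\<^sup>2)"
proof -
  have "2 ^ l * (bucket_size - 1) \<le> real p"
    using bucket_size_mult by (simp add: right_diff_distrib)
  then have "bucket_size - 1 \<le> real p / 2 ^ l" by (simp add: pos_le_divide_eq mult.commute)
  then have "moment_share \<le> real p / 2 ^ l / real p ^ 3"
    unfolding moment_share_def by (intro divide_right_mono) auto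
  also have "\<dots> = 1 / (2 ^ l * (real p)\<^sup>2)"
    using p_pos by (simp add: power2_eq_square power3_eq_cube)
  finally show ?thesis .
qed

text \<open>This amounts to \<open>1 \<le> (bucket_size - 1) * p\<close>. The resulting sign of
  \<open>moment_share - moment_disjoint\<close> allows the squared row sums in the variance to be
  replaced by an upper bound.\<close>

lemma moment_disjoint_le_share: "moment_disjoint \<le> moment_share"
proof -
  have "1 * 1 \<le> (bucket_size - 1) * real p"
    using bucket_size_ge p_pos by (intro mult_mono) auto
  then have "moment_disjoint \<le> (bucket_size - 1) * real p / real p ^ 4"
    unfolding moment_disjoint_def by (intro divide_right_mono) auto
  also have "\<dots> = moment_share"
    using p_pos by (simp add: moment_share_def power3_eq_cube power4_eq_xxxx)
  finally show ?thesis .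
qed

text \<open>The left side is the factor of \<open>F\<^sub>2\<^sup>2 - F\<^sub>4\<close> once
  Cauchy-Schwarz has bounded the row sums. The terms \<open>- 4Du\<close> and
  \<open>- 4B + 2D\<close> are nonpositive and dropped, leaving \<open>4Bu + 2A\<close>.\<close>

lemma variance_coefficient_le:
  "4 * (moment_share - moment_disjoint) * u + 2 * (moment_same - 2 * moment_share + moment_disjoint)
    \<le> 2 / 2 ^ l + (4 * real u + 2 * 2 ^ l) / (2 ^ l * (real p)\<^sup>2)"
proof -
  have "0 \<le> moment_disjoint" by (simp add: moment_disjoint_def)
  then have "0 \<le> moment_disjoint * u" by simp
  then have "4 * (moment_share - moment_disjoint) * u
      + 2 * (moment_same - 2 * moment_share + moment_disjoint) \<le> 4 * (moment_share * u) + 2 * moment_same"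
    using moment_disjoint_le_share \<open>0 \<le> moment_disjoint\<close>
        unfolding left_diff_distrib right_diff_distrib distrib_left mult.assoc by linarith
  also have "\<dots> \<le> 4 * (1 / (2 ^ l * (real p)\<^sup>2) * u) + 2 * (1 / 2 ^ l + 1 / (real p)\<^sup>2)"
    by (intro add_mono mult_left_mono mult_right_mono moment_same_le moment_share_le) auto
  also have "\<dots> = 2 / 2 ^ l + (4 * real u + 2 * 2 ^ l) / (2 ^ l * (real p)\<^sup>2)"
    using p_pos by (simp add: distrib_left add_divide_distrib)
  finally show ?thesis .
qed

lemma u_le_p_square: "(4 * real u + 2 * 2 ^ l) * u < 2 * (real p)\<^sup>2"
proof -
  have "real (2 * 2 ^ l) \<le> real u" "real (2 * u) \<le> real (Suc p)" "real 4 \<le> real u"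
    using two_pow_l_le_u two_u_le_Suc_p four_le_u by (simp_all only: of_nat_le_iff)
  \<comment> \<open>The factor 7/4 comes from \<open>p \<ge> 2u - 1\<close> and
    \<open>u \<ge> 4\<close>. It suffices because \<open>5 < 2 * (7/4)^2\<close>.\<close>
  then have *: "2 * 2 ^ l \<le> real u" "7 / 4 * real u \<le> real p" "4 \<le> real u"
    by simp_all
  have "(4 * real u + 2 * 2 ^ l) * u \<le> (4 * real u + real u) * u"
    using * by (intro mult_right_mono) auto
  also have "\<dots> < 2 * (7 / 4 * real u)\<^sup>2"
    using *(3) by (simp add: power2_eq_square)
  also have "\<dots> \<le> 2 * (real p)\<^sup>2"
    using *(2) by (intro mult_left_mono power_mono) auto
  finally show ?thesis .
qed

end

section \<open>Off-diagonal sums and the derivation of the three claims\<close>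

lemma sum_offdiagonal:
  fixes g :: "'a \<Rightarrow> real"
  assumes "finite I"
  shows "(\<Sum>x\<in>I. \<Sum>y\<in>I. of_bool (x \<noteq> y) * g x * g y) = (\<Sum>x\<in>I. g x)\<^sup>2 - (\<Sum>x\<in>I. (g x)\<^sup>2)"
proof -
  have "(\<Sum>y\<in>I. of_bool (x \<noteq> y) * g x * g y) = g x * (\<Sum>y\<in>I. g y) - (g x)\<^sup>2" if "x \<in> I" for x
  proof -
    have "(\<Sum>y\<in>I. of_bool (x \<noteq> y) * g x * g y) = (\<Sum>y\<in>I. g x * g y - (if y = x then (g x)\<^sup>2 else 0))"
      by (intro sum.cong) (auto simp: power2_eq_square)
    then show ?thesis
      using assms that by (simp add: sum_subtractf sum_distrib_left)
  qed
  then show ?thesis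
    by (simp add: sum_subtractf power2_eq_square flip: sum_distrib_right)
qed

theorem theorem2:
  fixes M :: "'w measure"
    and h :: "'w \<Rightarrow> nat \<Rightarrow> nat"
    and f :: "nat \<Rightarrow> int"
    and r u p b l n :: nat
    and F :: "nat \<Rightarrow> real"
    and X :: "'w \<Rightarrow> real"
  assumes "prob_space M"
    and "r > 1" and "r = 2 ^ l"
    and "u > r" and "\<exists>k. u = 2 ^ k"
    and "prime p" and "p = 2 ^ b - 1" and "p > u"
    and "k_universal M 4 {..<u} {..<p} h"
  defines "n \<equiv> card {x\<in>{..<u}. f x \<noteq> 0}"
    and "F \<equiv> \<lambda>m. real_of_int (freq_moment u f m)"
    and "X \<equiv> \<lambda>w. real_of_int (second_moment_estimate b l u f (h w))"
  shows "prob_space.expectation M X = F 2 + ((F 1)\<^sup>2 - F 2) / (real p)\<^sup>2 \<and>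
    \<bar>prob_space.expectation M X - F 2\<bar> \<le> F 2 * (real n - 1) / (real p)\<^sup>2 \<and>
    ((\<exists>x<u. f x \<noteq> 0) \<longrightarrow> prob_space.variance M X < 2 * (F 2)\<^sup>2 / real r)"
proof -
  have "l > 0" using \<open>r > 1\<close> \<open>r = 2 ^ l\<close> by (cases l) auto
  interpret count_sketch M h u p b l
    by (intro count_sketch.intro count_sketch_axioms.intro) (use assms \<open>l > 0\<close> in auto)
  define W where "W x y = of_bool (x \<noteq> y) * real_of_int (f x) * f y" for x y
  let ?Y = "\<lambda>w. \<Sum>x<u. \<Sum>y<u. W x y * collision x y w"
  have W_diag: "W x x = 0" and W_sym: "W x y = W y x" for x y
    by (auto simp: W_def)
  have X: "X w = F 2 + ?Y w" if "w \<in> space M" for w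
    unfolding X_def F_def W_def second_moment_estimate_eq[OF that] ..
  have Y_int: "integrable M ?Y"
    by (intro bounded_rv_integrable bounded_rv_sum bounded_rv_mult bounded_rv_const
        bounded_rv_collision) auto
  have EX: "expectation X = F 2 + expectation ?Y"
  proof -
    have "expectation X = expectation (\<lambda>w. F 2 + ?Y w)"
      by (intro Bochner_Integration.integral_cong X refl)
    also have "\<dots> = F 2 + expectation ?Y"
      using Y_int by (subst Bochner_Integration.integral_add) (simp_all add: prob_space)
    finally show ?thesis .
  qed
  have F1: "F 1 = (\<Sum>x<u. real_of_int (f x))" and F2: "F 2 = (\<Sum>x<u. (real_of_int (f x))\<^sup>2)"
    and F4: "F 4 = (\<Sum>x<u. ((real_of_int (f x))\<^sup>2)\<^sup>2)"
    by (simp_all add: F_def freq_moment_def flip: power_mult)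
  have EY: "expectation ?Y = ((F 1)\<^sup>2 - F 2) / (real p)\<^sup>2"
    unfolding expectation_quadratic_form[OF W_diag] F1 F2
    unfolding W_def sum_offdiagonal[OF finite_lessThan] ..
  have F2_nonneg: "0 \<le> F 2" unfolding F2 by (intro sum_nonneg) simp

  have "\<bar>(F 1)\<^sup>2 - F 2\<bar> \<le> F 2 * (real n - 1)"
  \<comment> \<open>For \<open>n = 0\<close> the factor \<open>real n - 1\<close> is negative, but
    both moments are zero.\<close>
  proof (cases "n = 0")
    case True
    then have "f x = 0" if "x < u" for x using that by (auto simp: n_def)
    then show ?thesis by (simp add: F1 F2 del: One_nat_def)
  next
    case False
    let ?S = "{x\<in>{..<u}. f x \<noteq> 0}"
    have F1S: "F 1 = (\<Sum>x\<in>?S. real_of_int (f x))" and F2S: "F 2 = (\<Sum>x\<in>?S. (real_of_int (f x))\<^sup>2)"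
      unfolding F1 F2 by (rule sum.mono_neutral_right; auto)+
    have upper: "(F 1)\<^sup>2 \<le> F 2 * n"
      unfolding F1S F2S n_def by (rule sum_squared_le_sum_of_squares)
    show ?thesis
    \<comment> \<open>Cauchy-Schwarz on the support settles the upper side. The lower side uses
      \<open>F 2 \<le> F 2 * (n - 1)\<close>, which needs \<open>n \<ge> 2\<close>; for
      \<open>n = 1\<close> the difference is zero.\<close>
    proof (cases "n = 1")
      case True
      then obtain a where "?S = {a}" unfolding n_def by (rule card_1_singletonE)
      then show ?thesis using True unfolding F1S F2S by simp
    next
      case n1: False
      then have "F 2 * 2 \<le> F 2 * n" using False F2_nonneg by (intro mult_left_mono) auto
      moreover have "0 \<le> (F 1)\<^sup>2" by simp
      ultimately show ?thesis
        using upper unfolding abs_le_iff right_diff_distrib by (intro conjI; linarith)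
    qed
  qed
  then have "\<bar>expectation X - F 2\<bar> \<le> F 2 * (real n - 1) / (real p)\<^sup>2"
    unfolding EX EY by (simp add: divide_right_mono)
  moreover have "variance X < 2 * (F 2)\<^sup>2 / real r" if nonzero: "\<exists>x<u. f x \<noteq> 0"
  proof -
    have p0: "0 < real p" using p_pos by simp
    have r: "real r = 2 ^ l" by (simp add: assms)
    \<comment> \<open>Squaring leaves the indicator in \<open>W\<close> unchanged, so this is the
      off-diagonal sum for the squared frequencies.\<close>
    have S: "(\<Sum>x<u. \<Sum>y<u. (W x y)\<^sup>2) = (F 2)\<^sup>2 - F 4"
      unfolding F2 F4 sum_offdiagonal[OF finite_lessThan, symmetric]
      by (intro sum.cong refl) (simp add: W_def power_mult_distrib)
    have S_nonneg: "0 \<le> (F 2)\<^sup>2 - F 4"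
      unfolding S[symmetric] by (intro sum_nonneg) simp
    \<comment> \<open>This makes the final inequality strict; for zero \<open>f\<close> both of its
      sides would be 0.\<close>
    have F4_pos: "0 < F 4"
    proof -
      obtain x where "x < u" "f x \<noteq> 0" using nonzero by blast
      then show ?thesis unfolding F4 by (intro sum_pos2[of _ x]) auto
    qed
    have F2_F4: "(F 2)\<^sup>2 \<le> F 4 * u"
      unfolding F2 F4
      using sum_squared_le_sum_of_squares[of "\<lambda>x. (real_of_int (f x))\<^sup>2" "{..<u}"] by simp
    \<comment> \<open>Cauchy-Schwarz in each row, which has \<open>u\<close> entries.\<close>
    have "(\<Sum>x<u. (\<Sum>y<u. W x y)\<^sup>2) \<le> (\<Sum>x<u. u * (\<Sum>y<u. (W x y)\<^sup>2))"
      by (intro sum_mono order_trans[OF sum_squared_le_sum_of_squares]) (simp add: mult.commute)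
    also have "\<dots> = u * ((F 2)\<^sup>2 - F 4)"
      unfolding S[symmetric] by (rule sum_distrib_left[symmetric])
    finally have T: "(\<Sum>x<u. (\<Sum>y<u. W x y)\<^sup>2) \<le> u * ((F 2)\<^sup>2 - F 4)" .
    have "variance X = variance ?Y"
      unfolding EX by (intro Bochner_Integration.integral_cong) (simp_all add: X)
    also have "\<dots> = 4 * (moment_share - moment_disjoint) * (\<Sum>x<u. (\<Sum>y<u. W x y)\<^sup>2)
        + 2 * (moment_same - 2 * moment_share + moment_disjoint) * ((F 2)\<^sup>2 - F 4)"
      unfolding variance_quadratic_form[OF W_diag W_sym] S ..
    also have "\<dots> \<le> 4 * (moment_share - moment_disjoint) * (u * ((F 2)\<^sup>2 - F 4))
        + 2 * (moment_same - 2 * moment_share + moment_disjoint) * ((F 2)\<^sup>2 - F 4)"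
      using T moment_disjoint_le_share by (intro add_right_mono mult_left_mono) auto
    also have "\<dots> = (4 * (moment_share - moment_disjoint) * u
        + 2 * (moment_same - 2 * moment_share + moment_disjoint)) * ((F 2)\<^sup>2 - F 4)"
      by (simp only: distrib_right mult.assoc)
    also have "\<dots> \<le> (2 / 2 ^ l + (4 * real u + 2 * 2 ^ l) / (2 ^ l * (real p)\<^sup>2)) * ((F 2)\<^sup>2 - F 4)"
      by (rule mult_right_mono[OF variance_coefficient_le S_nonneg])
    \<comment> \<open>The main term falls short of the target by \<open>2 * F 4 / 2 ^ l\<close>. The
      error term is smaller than this gap, by
      \<open>F\<^sub>2\<^sup>2 - F\<^sub>4 \<le> u F\<^sub>4\<close> and
      \<open>u_le_p_square\<close>.\<close>
    also have "\<dots> < 2 * (F 2)\<^sup>2 / 2 ^ l"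
    proof -
      have "(4 * real u + 2 * 2 ^ l) * ((F 2)\<^sup>2 - F 4) \<le> (4 * real u + 2 * 2 ^ l) * (F 4 * u)"
        using F2_F4 F4_pos by (intro mult_left_mono) auto
      also have "\<dots> < F 4 * (2 * (real p)\<^sup>2)"
        using mult_strict_left_mono[OF u_le_p_square F4_pos] by (simp add: mult_ac)
      finally have "(4 * real u + 2 * 2 ^ l) * ((F 2)\<^sup>2 - F 4) / (2 ^ l * (real p)\<^sup>2)
          < F 4 * (2 * (real p)\<^sup>2) / (2 ^ l * (real p)\<^sup>2)"
        using p0 by (intro divide_strict_right_mono) auto
      also have "\<dots> = 2 * F 4 / 2 ^ l" using p0 by simp
      finally have "2 / 2 ^ l * ((F 2)\<^sup>2 - F 4)
          + (4 * real u + 2 * 2 ^ l) * ((F 2)\<^sup>2 - F 4) / (2 ^ l * (real p)\<^sup>2)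
          < 2 / 2 ^ l * ((F 2)\<^sup>2 - F 4) + 2 * F 4 / 2 ^ l" by simp
      also have "\<dots> = 2 * (F 2)\<^sup>2 / 2 ^ l" by (simp flip: add_divide_distrib)
      finally show ?thesis by (simp only: distrib_right times_divide_eq_left)
    qed
    finally show ?thesis unfolding r .
  qed
  ultimately show ?thesis using EX EY by simp
qed

end
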